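(* Let $X$ be a complex $2$-dimensional Banach space and let $P_1,\ldots,P_n:X\to\mathbb C$ be homogeneous polynomials of degrees $k_1,\ldots,k_n\ge 1$. Then $$\|P_1\|\cdots\|P_n\|\leq c_{k}(X)\,\|P_1\cdots P_n\|,$$ where $k=\sum_{i=1}^n k_i$ and $c_k(X)$ is the $k$-th linear polarization constant of $X$.
   Context: For a Banach space $X$, $B_X$ is its unit ball. A function $P:X\to\mathbb C$ is a continuous $m$-homogeneous polynomial (of degree $m$) if there is a continuous $m$-linear function $T:X\times\cdots\times X\to\mathbb C$ with $P(z)=T(z,\ldots,z)$. The norm is $\|P\|=\sup_{z\in B_X}|P(z)|$, and products are pointwise. The $m$-th linear polarization constant $c_m(X)$ of $X$ is the smallest constant $M$ such that $\|\varphi_1\|\cdots\|\varphi_m\|\le M\,\|\varphi_1\cdots\varphi_m\|$ for all continuous linear functionals $\varphi_1,\ldots,\varphi_m$ on $X$. *)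

theory Defs
  imports "HOL-Analysis.Analysis"
begin

text \<open>
  The type class \<^class>\<open>banach\<close> describes real Banach spaces. A complex Banach space is such a space
  together with a complex scalar multiplication that extends the real one and for which the norm is
  absolutely homogeneous.
\<close>

locale complex_banach_space = vector_space scaleC
  for scaleC :: "complex \<Rightarrow> 'a::banach \<Rightarrow> 'a" (infixr \<open>*\<^sub>C\<close> 75) +
  assumes scaleC_of_real: "complex_of_real r *\<^sub>C x = r *\<^sub>R x"
    and norm_scaleC: "norm (c *\<^sub>C x) = cmod c * norm x"

text \<open>The elements of \<open>X\<^sup>m\<close> are the extensional functions \<open>{1..m} \<rightarrow> X\<close>.\<close>

definition continuous_multilinear ::
    "(complex \<Rightarrow> 'a::banach \<Rightarrow> 'a) \<Rightarrow> nat \<Rightarrow> ((nat \<Rightarrow> 'a) \<Rightarrow> complex) \<Rightarrow> bool" where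
  "continuous_multilinear scaleC m T \<longleftrightarrow>
     (\<forall>v \<in> {1..m} \<rightarrow>\<^sub>E UNIV. \<forall>i \<in> {1..m}. Vector_Spaces.linear scaleC (*) (\<lambda>x. T (v(i := x)))) \<and>
     continuous_map (product_topology (\<lambda>_. euclidean) {1..m}) euclidean T"

definition continuous_homogeneous_polynomial ::
    "(complex \<Rightarrow> 'a::banach \<Rightarrow> 'a) \<Rightarrow> nat \<Rightarrow> ('a \<Rightarrow> complex) \<Rightarrow> bool" where
  "continuous_homogeneous_polynomial scaleC m P \<longleftrightarrow>
     (\<exists>T. continuous_multilinear scaleC m T \<and> (\<forall>z. P z = T (\<lambda>i\<in>{1..m}. z)))"

definition continuous_linear_functional ::
    "(complex \<Rightarrow> 'a::banach \<Rightarrow> 'a) \<Rightarrow> ('a \<Rightarrow> complex) \<Rightarrow> bool" where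
  "continuous_linear_functional scaleC \<phi> \<longleftrightarrow>
     Vector_Spaces.linear scaleC (*) \<phi> \<and> continuous_on UNIV \<phi>"

definition unit_ball_norm :: "('a::banach \<Rightarrow> complex) \<Rightarrow> real" where
  "unit_ball_norm P = (SUP z \<in> cball 0 1. cmod (P z))"

text \<open>
  The constant is the literal \<open>LEAST\<close> real number, hence meaningful only where such a least number
  exists, as it does for every finite-dimensional \<open>X \<noteq> 0\<close> and \<open>m \<ge> 1\<close>.
\<close>

definition linear_polarization_constant ::
    "(complex \<Rightarrow> 'a::banach \<Rightarrow> 'a) \<Rightarrow> nat \<Rightarrow> real" where
  "linear_polarization_constant scaleC m =
     (LEAST M. \<forall>\<phi> :: nat \<Rightarrow> 'a \<Rightarrow> complex.
        (\<forall>i \<in> {1..m}. continuous_linear_functional scaleC (\<phi> i)) \<longrightarrow>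
        (\<Prod>i=1..m. unit_ball_norm (\<phi> i)) \<le> M * unit_ball_norm (\<lambda>z. \<Prod>i=1..m. \<phi> i z))"

end

theory Submission
  imports Defs "HOL-Computational_Algebra.Fundamental_Theorem_Algebra"
begin

text \<open>
  In dimension two the statement about polynomials is an instance of the one about functionals.  With
  respect to a basis, a homogeneous polynomial of degree \<open>m\<close> is a binary form of degree \<open>m\<close>, and over
  the algebraically closed field \<open>\<complex>\<close> a binary form is a product of linear forms
  (\<open>binary_form_splits\<close>, \<open>homogeneous_polynomial_splits\<close>).  Writing
  \<open>P\<^sub>i = \<phi>\<^sub>i\<^sub>1 \<cdots> \<phi>\<^sub>i\<^sub>k\<close> with \<open>k = k\<^sub>i\<close>, the norm of each \<open>P\<^sub>i\<close> is at most the product of the norms of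
  its factors, while the product of all the \<open>\<phi>\<^sub>i\<^sub>j\<close> is \<open>P\<^sub>1 \<cdots> P\<^sub>n\<close>; hence the inequality
  that defines the linear polarization constant, applied to all factors at once, gives the claim.

  For this the constant must satisfy its own defining inequality.  The admissible constants
  form an intersection of closed half-lines, so a least one exists as soon as there is any
  (\<open>Least_ratio_bound\<close>).  That there is one is proved by exhibiting, for given
  functionals \<open>\<phi>\<^sub>1, \<dots>, \<phi>\<^sub>m\<close>, a vector at which none of them is small.  On the line
  \<open>s \<mapsto> b\<^sub>1 + s b\<^sub>2\<close> a functional can be small for at most one of the integers \<open>s = 0, \<dots>, m\<close>, so some
  of these \<open>m + 1\<close> values is good for all \<open>m\<close> functionals (\<open>common_large_value\<close>).
\<close>

section \<open>Factorization of binary forms\<close>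

definition binary_form :: "nat \<Rightarrow> complex poly \<Rightarrow> complex \<Rightarrow> complex \<Rightarrow> complex" where
  "binary_form m p x y = (\<Sum>j\<le>m. coeff p j * x ^ (m - j) * y ^ j)"

text \<open>
  This recursion drives both the factorization and the expansion of multilinear maps.  With
  \<open>q = 0\<close> it covers a polynomial whose degree is less than that of the form, and with \<open>p = - r q\<close> it
  splits off a root \<open>r\<close> of the polynomial \<open>(Y - r) q\<close>.
\<close>

lemma binary_form_Suc:
  assumes "degree p \<le> m"
  shows "binary_form (Suc m) (p + pCons 0 q) x y = x * binary_form m p x y + y * binary_form m q x y"
proof -
  have "coeff p (Suc m) = 0"
    using assms by (simp add: coeff_eq_0)
  then have "(\<Sum>j\<le>Suc m. coeff p j * x ^ (Suc m - j) * y ^ j) = x * binary_form m p x y"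
    by (simp add: binary_form_def sum_distrib_left Suc_diff_le ac_simps)
  moreover have "(\<Sum>j\<le>Suc m. coeff (pCons 0 q) j * x ^ (Suc m - j) * y ^ j) = y * binary_form m q x y"
    unfolding sum.atMost_Suc_shift
    by (simp add: binary_form_def sum_distrib_left ac_simps)
  ultimately show ?thesis
    by (simp add: binary_form_def algebra_simps sum.distrib)
qed

lemma binary_form_splits:
  assumes "degree p \<le> m"
  shows "\<exists>c \<alpha> \<beta>. \<forall>x y. binary_form m p x y = c * (\<Prod>i=1..m. \<alpha> i * x + \<beta> i * y)"
  using assms
proof (induction m arbitrary: p)
  case 0
  then show ?case by (auto simp: binary_form_def)
next
  case (Suc m)
  have "\<exists>q a b. degree q \<le> m \<and> (\<forall>x y. binary_form (Suc m) p x y = (a * x + b * y) * binary_form m q x y)"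
  proof (cases "degree p \<le> m")
    case True
    then have "\<forall>x y. binary_form (Suc m) p x y = (1 * x + 0 * y) * binary_form m p x y"
      using binary_form_Suc[of p m 0] by (simp add: binary_form_def)
    with True show ?thesis by blast
  next
    case False
    then have deg: "degree p = Suc m" using Suc.prems by simp
    then have "\<not> constant (poly p)"
      by (simp add: constant_degree)
    then obtain r where "poly p r = 0"
      using fundamental_theorem_of_algebra by blast
    then obtain q where q: "p = [:- r, 1:] * q"
      by (auto simp: poly_eq_0_iff_dvd)
    have "q \<noteq> 0" using q deg by auto
    then have dq: "degree q = m"
      using deg by (simp add: q degree_mult_eq del: mult_pCons_left)
    have p_eq: "p = smult (- r) q + pCons 0 q" by (simp add: q)
    have "binary_form m (smult (- r) q) x y = - r * binary_form m q x y" for x y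
      by (simp add: binary_form_def sum_distrib_left mult.assoc sum_negf)
    moreover have "degree (smult (- r) q) \<le> m"
      using dq degree_smult_le[of "- r" q] by simp
    ultimately have "\<forall>x y. binary_form (Suc m) p x y = ((- r) * x + 1 * y) * binary_form m q x y"
      unfolding p_eq by (simp only: binary_form_Suc) (simp add: algebra_simps)
    with dq show ?thesis by blast
  qed
  then obtain q a b where q: "degree q \<le> m"
    and pq: "\<And>x y. binary_form (Suc m) p x y = (a * x + b * y) * binary_form m q x y" by blast
  from Suc.IH[OF q] obtain c \<alpha> \<beta> where
    IH: "\<And>x y. binary_form m q x y = c * (\<Prod>i=1..m. \<alpha> i * x + \<beta> i * y)" by blast
  have "binary_form (Suc m) p x y =
      c * (\<Prod>i=1..Suc m. (\<alpha>(Suc m := a)) i * x + (\<beta>(Suc m := b)) i * y)" for x y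
  proof -
    have "(\<Prod>i=1..m. (\<alpha>(Suc m := a)) i * x + (\<beta>(Suc m := b)) i * y) = (\<Prod>i=1..m. \<alpha> i * x + \<beta> i * y)"
      by (rule prod.cong) auto
    then show ?thesis by (simp add: pq IH)
  qed
  then show ?case by blast
qed

section \<open>Norms on the unit ball and least constants\<close>

definition bounded_on_unit_ball :: "('a::banach \<Rightarrow> complex) \<Rightarrow> bool" where
  "bounded_on_unit_ball f \<longleftrightarrow> bdd_above ((\<lambda>z. cmod (f z)) ` cball 0 1)"

lemma bounded_on_unit_ballI:
  assumes "\<And>z. z \<in> cball 0 1 \<Longrightarrow> cmod (f z) \<le> M"
  shows "bounded_on_unit_ball f"
  unfolding bounded_on_unit_ball_def by (rule bdd_aboveI2[of _ _ M]) (use assms in auto)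

lemma unit_ball_norm_upper:
  assumes "bounded_on_unit_ball f" "z \<in> cball 0 1"
  shows "cmod (f z) \<le> unit_ball_norm f"
  using assms unfolding bounded_on_unit_ball_def unit_ball_norm_def by (intro cSUP_upper)

lemma unit_ball_norm_least:
  assumes "\<And>z. z \<in> cball 0 1 \<Longrightarrow> cmod (f z) \<le> M"
  shows "unit_ball_norm f \<le> M"
  unfolding unit_ball_norm_def by (rule cSUP_least) (use assms in auto)

lemma unit_ball_norm_nonneg:
  assumes "bounded_on_unit_ball f"
  shows "0 \<le> unit_ball_norm f"
  using unit_ball_norm_upper[OF assms, of 0] order_trans[OF norm_ge_zero] by auto

lemma cmod_prod_le_unit_ball_norms:
  assumes "\<And>i. i \<in> I \<Longrightarrow> bounded_on_unit_ball (f i)" "z \<in> cball 0 1"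
  shows "cmod (\<Prod>i\<in>I. f i z) \<le> (\<Prod>i\<in>I. unit_ball_norm (f i))"
  unfolding prod_norm[symmetric] by (intro prod_mono) (use assms unit_ball_norm_upper in auto)

lemma bounded_on_unit_ball_prod:
  assumes "\<And>i. i \<in> I \<Longrightarrow> bounded_on_unit_ball (f i)"
  shows "bounded_on_unit_ball (\<lambda>z. \<Prod>i\<in>I. f i z)"
  using cmod_prod_le_unit_ball_norms[OF assms] by (rule bounded_on_unit_ballI)

lemma unit_ball_norm_prod_le:
  assumes "\<And>i. i \<in> I \<Longrightarrow> bounded_on_unit_ball (f i)"
  shows "unit_ball_norm (\<lambda>z. \<Prod>i\<in>I. f i z) \<le> (\<Prod>i\<in>I. unit_ball_norm (f i))"
  using cmod_prod_le_unit_ball_norms[OF assms] by (rule unit_ball_norm_least)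

text \<open>
  Each \<open>f\<close> cuts out a half-line of admissible \<open>M\<close> that is closed, so the infimum of
  the admissible constants is admissible.  An \<open>f\<^sub>0\<close> with \<open>N f\<^sub>0 > 0\<close> keeps the
  infimum finite.
\<close>

lemma Least_ratio_bound:
  fixes A N :: "'b \<Rightarrow> real"
  assumes N: "\<And>f. Q f \<Longrightarrow> 0 \<le> N f"
    and bound: "\<And>f. Q f \<Longrightarrow> A f \<le> M * N f"
    and f0: "Q f0" "0 < N f0"
    and f: "Q f"
  shows "A f \<le> (LEAST M. \<forall>f. Q f \<longrightarrow> A f \<le> M * N f) * N f"
proof -
  define S where "S = {M. \<forall>f. Q f \<longrightarrow> A f \<le> M * N f}"
  have "M \<in> S" using bound by (simp add: S_def)
  have "A f0 / N f0 \<le> M'" if "M' \<in> S" for M'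
    using that f0 by (simp add: S_def divide_le_eq)
  then have bdd: "bdd_below S" by (rule bdd_belowI)
  have adm: "A g \<le> Inf S * N g" if g: "Q g" for g
  proof (cases "N g = 0")
    case True
    then show ?thesis using bound[OF g] by simp
  next
    case False
    then have pos: "0 < N g" using N[OF g] by simp
    have "A g / N g \<le> Inf S"
      using \<open>M \<in> S\<close> by (intro cInf_greatest) (use g pos in \<open>auto simp: S_def divide_le_eq\<close>)
    then show ?thesis using pos by (simp add: divide_le_eq)
  qed
  have "(LEAST M. M \<in> S) = Inf S"
    by (rule Least_equality) (use adm bdd in \<open>auto simp: S_def intro: cInf_lower\<close>)
  then show ?thesis using adm[OF f] by (simp add: S_def)
qed

text \<open>
  If \<open>s \<mapsto> a\<^sub>i + s b\<^sub>i\<close> were small at two different integers, then both of its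
  coefficients would be small: \<open>b\<^sub>i\<close> is bounded by the difference of the two values, and then \<open>a\<^sub>i\<close> by
  either value.  The factor \<open>2 m + 3\<close> makes these two estimates add up to
  a contradiction.
\<close>

lemma common_large_value:
  fixes a b :: "nat \<Rightarrow> complex"
  shows "\<exists>s\<le>m. \<forall>i\<in>{1..m}. cmod (a i) + cmod (b i) \<le> (2 * real m + 3) * cmod (a i + of_nat s * b i)"
proof (rule ccontr)
  let ?K = "2 * real m + 3"
  assume "\<not> ?thesis"
  then have "\<forall>s\<in>{0..m}. \<exists>i. i \<in> {1..m} \<and> ?K * cmod (a i + of_nat s * b i) < cmod (a i) + cmod (b i)"
    unfolding Bex_def Ball_def atLeastAtMost_iff not_le[symmetric] by blast
  then obtain g where g: "\<And>s. s \<in> {0..m} \<Longrightarrow> g s \<in> {1..m}"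
    and small: "\<And>s. s \<in> {0..m} \<Longrightarrow>
      ?K * cmod (a (g s) + of_nat s * b (g s)) < cmod (a (g s)) + cmod (b (g s))"
    by metis
  have "card (g ` {0..m}) \<le> card {1..m}"
    using g by (intro card_mono) auto
  then have "\<not> inj_on g {0..m}"
    by (intro pigeonhole) simp
  then obtain s t where st: "s \<in> {0..m}" "t \<in> {0..m}" "s \<noteq> t" "g s = g t"
    by (auto simp: inj_on_def)
  define x where "x = a (g s)"
  define y where "y = b (g s)"
  have xs: "?K * cmod (x + of_nat s * y) < cmod x + cmod y"
    and xt: "?K * cmod (x + of_nat t * y) < cmod x + cmod y"
    using small[OF st(1)] small[OF st(2)] st(4) by (simp_all add: x_def y_def)
  have "1 \<le> \<bar>real s - real t\<bar>"
    using st(3) by linarith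
  then have "cmod y \<le> \<bar>real s - real t\<bar> * cmod y"
    by (simp add: mult_le_cancel_right1)
  also have "\<dots> = cmod ((of_real (real s - real t)) * y)"
    by (simp only: norm_mult norm_of_real)
  also have "\<dots> = cmod ((x + of_nat s * y) - (x + of_nat t * y))"
    by (simp add: algebra_simps)
  also have "\<dots> \<le> cmod (x + of_nat s * y) + cmod (x + of_nat t * y)"
    by (rule norm_triangle_ineq4)
  finally have "?K * cmod y \<le> ?K * (cmod (x + of_nat s * y) + cmod (x + of_nat t * y))"
    by (rule mult_left_mono) simp
  then have y_less: "?K * cmod y < 2 * (cmod x + cmod y)"
    using xs xt unfolding distrib_left by linarith
  have "cmod x = cmod ((x + of_nat s * y) - of_nat s * y)" by simp
  also have "\<dots> \<le> cmod (x + of_nat s * y) + real s * cmod y"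
    using norm_triangle_ineq4[of "x + of_nat s * y" "of_nat s * y"] by (simp only: norm_mult norm_of_nat)
  also have "\<dots> \<le> cmod (x + of_nat s * y) + real m * cmod y"
    using st(1) by (simp add: mult_right_mono)
  finally have "?K * cmod x \<le> ?K * (cmod (x + of_nat s * y) + real m * cmod y)"
    by (rule mult_left_mono) simp
  also have "\<dots> = ?K * cmod (x + of_nat s * y) + real m * (?K * cmod y)"
    by (simp add: algebra_simps)
  also have "\<dots> \<le> ?K * cmod (x + of_nat s * y) + real m * (2 * (cmod x + cmod y))"
    using y_less by (intro add_left_mono mult_left_mono) auto
  finally have "?K * cmod x < (1 + 2 * real m) * (cmod x + cmod y)"
    using xs by (simp add: algebra_simps)
  with y_less show False by (simp add: algebra_simps)
qed

section \<open>Complex planes with coordinates\<close>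

text \<open>
  The coordinates \<open>u\<close> and \<open>v\<close> with respect to the basis \<open>b\<^sub>1, b\<^sub>2\<close> are parameters: choosing
  them once avoids carrying the representation of vectors over a basis set through the proofs.
\<close>

locale complex_plane = complex_banach_space +
  fixes b1 b2 :: 'a and u v :: "'a \<Rightarrow> complex"
  assumes linear_u: "Vector_Spaces.linear scaleC (*) u"
    and linear_v: "Vector_Spaces.linear scaleC (*) v"
    and basis_expansion: "z = u z *\<^sub>C b1 + v z *\<^sub>C b2"
    and dual_basis: "u b1 = 1" "u b2 = 0" "v b1 = 0" "v b2 = 1"

lemma (in complex_banach_space) complex_plane_if_dim_2:
  assumes "dim UNIV = 2"
  shows "\<exists>b1 b2 u v. complex_plane scaleC b1 b2 u v"
proof -
  obtain B where B: "independent B" "UNIV \<subseteq> span B" "card B = 2"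
    using basis_exists[of UNIV] assms by metis
  then have sp: "span B = UNIV" by auto
  obtain b1 b2 where b: "B = {b1, b2}" "b1 \<noteq> b2"
    using B(3) by (auto simp: card_2_iff)
  have "complex_plane scaleC b1 b2 (\<lambda>z. representation B z b1) (\<lambda>z. representation B z b2)"
  proof (intro complex_plane.intro complex_plane_axioms.intro complex_banach_space_axioms)
    show "Vector_Spaces.linear scaleC (*) (\<lambda>z. representation B z b1)"
      "Vector_Spaces.linear scaleC (*) (\<lambda>z. representation B z b2)"
      using linear_representation[OF B(1) sp] by auto
    show "z = representation B z b1 *\<^sub>C b1 + representation B z b2 *\<^sub>C b2" for z
      using sum_representation_eq[OF B(1), of z B] sp b by auto
  qed (use b B(1) in \<open>auto simp: representation_basis\<close>)
  then show ?thesis by blast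
qed

context complex_plane
begin

lemma coordinates [simp]:
  "u (x *\<^sub>C b1 + y *\<^sub>C b2) = x" "v (x *\<^sub>C b1 + y *\<^sub>C b2) = y"
  using linear_u linear_v by (simp_all add: Vector_Spaces.linear_iff dual_basis)

lemma linear_functional_expansion:
  assumes "Vector_Spaces.linear scaleC (*) \<phi>"
  shows "\<phi> z = \<phi> b1 * u z + \<phi> b2 * v z"
proof -
  have "\<phi> z = \<phi> (u z *\<^sub>C b1 + v z *\<^sub>C b2)"
    using basis_expansion[of z] by simp
  then show ?thesis
    using assms by (simp add: Vector_Spaces.linear_iff mult.commute)
qed

text \<open>
  The norm of \<open>x b\<^sub>1 + y b\<^sub>2\<close> is continuous and positive on the compact unit sphere of \<open>\<complex> \<times> \<complex>\<close>, so it is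
  bounded below there by a positive constant.
\<close>

lemma coordinates_bounded: "\<exists>C>0. \<forall>z. cmod (u z) \<le> C * norm z \<and> cmod (v z) \<le> C * norm z"
proof -
  define f where "f w = fst w *\<^sub>C b1 + snd w *\<^sub>C b2" for w :: "complex \<times> complex"
  have f_scaleR: "f (r *\<^sub>R w) = r *\<^sub>R f w" for r w
    by (simp add: f_def scaleC_of_real[symmetric] scale_right_distrib scaleR_conv_of_real)
  have cont_scaleC: "continuous_on UNIV (\<lambda>c. c *\<^sub>C b)" for b
  proof (rule linear_continuous_on, rule bounded_linear_intro)
    show "norm (c *\<^sub>C b) \<le> norm c * norm b" for c by (simp add: norm_scaleC)
  qed (simp_all add: scale_left_distrib scaleC_of_real[symmetric] scaleR_conv_of_real)
  have cont: "continuous_on (sphere 0 1) (\<lambda>w. norm (f w))"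
    unfolding f_def
    by (intro continuous_intros continuous_on_compose2[OF cont_scaleC]) auto
  have "(1, 0) \<in> sphere (0 :: complex \<times> complex) 1"
    by (simp add: norm_Pair)
  then obtain w0 where w0: "w0 \<in> sphere 0 1" "\<And>w. w \<in> sphere 0 1 \<Longrightarrow> norm (f w0) \<le> norm (f w)"
    using continuous_attains_inf[OF compact_sphere _ cont] by blast
  define \<mu> where "\<mu> = norm (f w0)"
  have "f w0 \<noteq> 0"
  proof
    assume "f w0 = 0"
    then have "fst w0 = u 0" "snd w0 = v 0"
      using coordinates[of "fst w0" "snd w0"] by (simp_all add: f_def)
    moreover have "u 0 = 0" "v 0 = 0"
      using coordinates[of 0 0] by simp_all
    ultimately show False using w0(1) by (simp add: prod_eq_iff norm_prod_def)
  qed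
  then have \<mu>: "0 < \<mu>" by (simp add: \<mu>_def)
  have lower: "\<mu> * norm w \<le> norm (f w)" for w
  proof (cases "w = 0")
    case True
    then show ?thesis by simp
  next
    case False
    then have "\<mu> \<le> norm (f ((1 / norm w) *\<^sub>R w))"
      unfolding \<mu>_def by (intro w0(2)) simp
    also have "\<dots> = norm (f w) / norm w"
      by (simp add: f_scaleR)
    finally show ?thesis using False by (simp add: le_divide_eq)
  qed
  have "cmod (u z) \<le> (1 / \<mu>) * norm z \<and> cmod (v z) \<le> (1 / \<mu>) * norm z" for z
  proof -
    have "f (u z, v z) = z" using basis_expansion[of z] by (simp add: f_def)
    then have "norm (u z, v z) \<le> norm z / \<mu>"
      using lower[of "(u z, v z)"] \<mu> by (simp add: le_divide_eq mult.commute)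
    then show ?thesis
      using norm_fst_le[of "u z" "v z"] norm_snd_le[of "v z" "u z"] by simp
  qed
  then show ?thesis using \<mu> by (intro exI[of _ "1 / \<mu>"]) auto
qed

lemma linear_functional_bounded:
  "\<exists>C>0. \<forall>\<phi> z. Vector_Spaces.linear scaleC (*) \<phi> \<longrightarrow>
     cmod (\<phi> z) \<le> C * (cmod (\<phi> b1) + cmod (\<phi> b2)) * norm z"
proof -
  obtain C where C: "C > 0" "\<And>z. cmod (u z) \<le> C * norm z" "\<And>z. cmod (v z) \<le> C * norm z"
    using coordinates_bounded by blast
  have "cmod (\<phi> z) \<le> C * (cmod (\<phi> b1) + cmod (\<phi> b2)) * norm z"
    if "Vector_Spaces.linear scaleC (*) \<phi>" for \<phi> z
  proof -
    have "cmod (\<phi> z) \<le> cmod (\<phi> b1) * cmod (u z) + cmod (\<phi> b2) * cmod (v z)"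
      using norm_triangle_ineq[of "\<phi> b1 * u z" "\<phi> b2 * v z"] linear_functional_expansion[OF that, of z]
      by (simp add: norm_mult)
    also have "\<dots> \<le> cmod (\<phi> b1) * (C * norm z) + cmod (\<phi> b2) * (C * norm z)"
      using C by (intro add_mono mult_left_mono) auto
    finally show ?thesis by (simp add: algebra_simps)
  qed
  with C(1) show ?thesis by blast
qed

lemma linear_functional_bounded_on_unit_ball:
  assumes "Vector_Spaces.linear scaleC (*) \<phi>"
  shows "bounded_on_unit_ball \<phi>"
proof -
  obtain C where C: "C > 0" "\<And>z. cmod (\<phi> z) \<le> C * (cmod (\<phi> b1) + cmod (\<phi> b2)) * norm z"
    using linear_functional_bounded assms by blast
  show ?thesis
  proof (rule bounded_on_unit_ballI)
    fix z :: 'a assume "z \<in> cball 0 1"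
    then have "C * (cmod (\<phi> b1) + cmod (\<phi> b2)) * norm z \<le> C * (cmod (\<phi> b1) + cmod (\<phi> b2)) * 1"
      using C(1) by (intro mult_left_mono) auto
    with C(2)[of z] show "cmod (\<phi> z) \<le> C * (cmod (\<phi> b1) + cmod (\<phi> b2)) * 1" by linarith
  qed
qed

lemma linear_combination_functional:
  "continuous_linear_functional scaleC (\<lambda>z. a * u z + b * v z)"
proof -
  let ?\<phi> = "\<lambda>z. a * u z + b * v z"
  have lin: "Vector_Spaces.linear scaleC (*) ?\<phi>"
    using linear_u linear_v by (simp add: Vector_Spaces.linear_iff algebra_simps)
  obtain C where C: "\<And>z. cmod (?\<phi> z) \<le> C * (cmod (?\<phi> b1) + cmod (?\<phi> b2)) * norm z"
    using linear_functional_bounded lin by blast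
  have "bounded_linear ?\<phi>"
  proof (rule bounded_linear_intro)
    show "?\<phi> (x + y) = ?\<phi> x + ?\<phi> y" for x y
      using lin by (simp only: Vector_Spaces.linear_iff)
    show "?\<phi> (r *\<^sub>R x) = r *\<^sub>R ?\<phi> x" for r x
      using lin by (simp only: Vector_Spaces.linear_iff scaleC_of_real[symmetric] scaleR_conv_of_real)
    show "norm (?\<phi> x) \<le> norm x * (C * (cmod (?\<phi> b1) + cmod (?\<phi> b2)))" for x
      using C[of x] by (simp add: mult.commute)
  qed
  then show ?thesis
    using lin by (simp add: continuous_linear_functional_def linear_continuous_on)
qed

section \<open>Homogeneous polynomials are products of functionals\<close>

text \<open>
  Expanding the arguments one at a time: after the first \<open>j\<close> arguments have been
  replaced by the same vector, the value is a binary form of degree \<open>j\<close> in its coordinates, for arbitrary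
  remaining arguments \<open>w\<close>.
\<close>

lemma multilinear_diagonal_binary_form:
  assumes "continuous_multilinear scaleC m T" "j \<le> m"
  shows "\<exists>p. degree p \<le> j \<and>
    (\<forall>z. T (\<lambda>i\<in>{1..m}. if i \<le> j then z else w i) = binary_form j p (u z) (v z))"
  using assms(2)
proof (induction j arbitrary: w)
  case 0
  have "(\<lambda>i\<in>{1..m}. if i \<le> 0 then z else w i) = (\<lambda>i\<in>{1..m}. w i)" for z
    by (auto simp: fun_eq_iff)
  then show ?case
    by (intro exI[of _ "[:T (\<lambda>i\<in>{1..m}. w i):]"]) (simp add: binary_form_def del: One_nat_def restrict_apply)
next
  case (Suc j)
  obtain p where p: "degree p \<le> j"
    "\<And>z. T (\<lambda>i\<in>{1..m}. if i \<le> j then z else (w(Suc j := b1)) i) = binary_form j p (u z) (v z)"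
    using Suc.IH[of "w(Suc j := b1)"] Suc_leD[OF Suc.prems] by blast
  obtain q where q: "degree q \<le> j"
    "\<And>z. T (\<lambda>i\<in>{1..m}. if i \<le> j then z else (w(Suc j := b2)) i) = binary_form j q (u z) (v z)"
    using Suc.IH[of "w(Suc j := b2)"] Suc_leD[OF Suc.prems] by blast
  have "T (\<lambda>i\<in>{1..m}. if i \<le> Suc j then z else w i) = binary_form (Suc j) (p + pCons 0 q) (u z) (v z)" for z
  proof -
    define V where "V = (\<lambda>i\<in>{1..m}. if i \<le> j then z else w i)"
    have V_upd: "(\<lambda>i\<in>{1..m}. if i \<le> j then z else (w(Suc j := x)) i) = V(Suc j := x)" for x
      using Suc.prems by (auto simp: V_def fun_eq_iff)
    have "(\<lambda>i\<in>{1..m}. if i \<le> Suc j then z else w i) = V(Suc j := z)"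
      using Suc.prems by (auto simp: V_def fun_eq_iff)
    moreover have "V \<in> {1..m} \<rightarrow>\<^sub>E UNIV"
      by (simp add: V_def)
    then have "Vector_Spaces.linear scaleC (*) (\<lambda>x. T (V(Suc j := x)))"
      using assms(1) Suc.prems by (auto simp: continuous_multilinear_def)
    from linear_functional_expansion[OF this, of z]
    have "T (V(Suc j := z)) = u z * T (V(Suc j := b1)) + v z * T (V(Suc j := b2))"
      by (simp add: mult.commute)
    ultimately show ?thesis
      using p(1) p(2)[of z] q(2)[of z] unfolding V_upd by (simp add: binary_form_Suc)
  qed
  moreover have "degree (p + pCons 0 q) \<le> Suc j"
    using p(1) q(1) by (intro degree_add_le) (auto simp: degree_pCons_eq_if)
  ultimately show ?case by blast
qed

lemma homogeneous_polynomial_splits: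
  assumes "continuous_homogeneous_polynomial scaleC m P" "m \<ge> 1"
  shows "\<exists>\<phi>. (\<forall>j. continuous_linear_functional scaleC (\<phi> j)) \<and> (\<forall>z. P z = (\<Prod>j=1..m. \<phi> j z))"
proof -
  obtain T where T: "continuous_multilinear scaleC m T" "\<And>z. P z = T (\<lambda>i\<in>{1..m}. z)"
    using assms(1) by (auto simp: continuous_homogeneous_polynomial_def)
  obtain p where p: "degree p \<le> m"
    "\<And>z. T (\<lambda>i\<in>{1..m}. if i \<le> m then z else undefined) = binary_form m p (u z) (v z)"
    using multilinear_diagonal_binary_form[OF T(1) order_refl, of "\<lambda>_. undefined"] by blast
  have "(\<lambda>i\<in>{1..m}. if i \<le> m then z else undefined) = (\<lambda>i\<in>{1..m}. z)" for z :: 'a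
    by (auto simp: fun_eq_iff)
  then have P: "P z = binary_form m p (u z) (v z)" for z
    using T(2) p(2) by simp
  obtain c \<alpha> \<beta> where split: "\<And>x y. binary_form m p x y = c * (\<Prod>i=1..m. \<alpha> i * x + \<beta> i * y)"
    using binary_form_splits[OF p(1)] by blast
  \<comment> \<open>The leading constant is absorbed into the first factor, which exists since \<open>m \<ge> 1\<close>.\<close>
  define e where "e j = (if j = 1 then c else 1)" for j :: nat
  have "(\<Prod>j=1..m. e j) = c"
    using assms(2) by (simp add: e_def)
  then have "P z = (\<Prod>j=1..m. (e j * \<alpha> j) * u z + (e j * \<beta> j) * v z)" for z
    by (simp add: P split prod.distrib[symmetric] distrib_left mult.assoc flip: \<open>prod e {1..m} = c\<close>)
  then show ?thesis
    using linear_combination_functional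
    by (intro exI[of _ "\<lambda>j z. (e j * \<alpha> j) * u z + (e j * \<beta> j) * v z"]) blast
qed

section \<open>The linear polarization constant of a complex plane\<close>

text \<open>
  The bound is the value of the product at the normalization of the vector \<open>b\<^sub>1 + s b\<^sub>2\<close> that
  \<open>common_large_value\<close> provides; \<open>R\<close> bounds the norm of these vectors for all \<open>s \<le> m\<close>.
\<close>

lemma polarization_bound_exists:
  fixes m :: nat
  shows "\<exists>M. \<forall>\<phi>. (\<forall>i\<in>{1..m}. continuous_linear_functional scaleC (\<phi> i)) \<longrightarrow>
     (\<Prod>i=1..m. unit_ball_norm (\<phi> i)) \<le> M * unit_ball_norm (\<lambda>z. \<Prod>i=1..m. \<phi> i z)"
proof -
  obtain C where C: "C > 0" "\<And>\<phi> z. Vector_Spaces.linear scaleC (*) \<phi> \<Longrightarrow>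
      cmod (\<phi> z) \<le> C * (cmod (\<phi> b1) + cmod (\<phi> b2)) * norm z"
    using linear_functional_bounded by blast
  define R where "R = norm b1 + real m * norm b2"
  define K where "K = 2 * real m + 3"
  have "b1 \<noteq> 0"
    using dual_basis coordinates(1)[of 0 0] by auto
  then have R: "R > 0" by (simp add: R_def add_pos_nonneg)
  have K: "K > 0" by (simp add: K_def)
  have "(\<Prod>i=1..m. unit_ball_norm (\<phi> i)) \<le> (C * K * R) ^ m * unit_ball_norm (\<lambda>z. \<Prod>i=1..m. \<phi> i z)"
    if \<phi>: "\<And>i. i \<in> {1..m} \<Longrightarrow> Vector_Spaces.linear scaleC (*) (\<phi> i)" for \<phi>
  proof -
    obtain s where s: "s \<le> m"
      and large: "\<And>i. i \<in> {1..m} \<Longrightarrow>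
        cmod (\<phi> i b1) + cmod (\<phi> i b2) \<le> K * cmod (\<phi> i b1 + of_nat s * \<phi> i b2)"
      using common_large_value[of m "\<lambda>i. \<phi> i b1" "\<lambda>i. \<phi> i b2"] unfolding K_def by blast
    define z where "z = complex_of_real (1 / R) *\<^sub>C (b1 + of_nat s *\<^sub>C b2)"
    have "norm (b1 + of_nat s *\<^sub>C b2) \<le> norm b1 + real s * norm b2"
      using norm_triangle_ineq[of b1 "of_nat s *\<^sub>C b2"] by (simp add: norm_scaleC)
    also have "\<dots> \<le> R"
      using s by (simp add: R_def mult_right_mono)
    finally have z: "z \<in> cball 0 1"
      using R by (simp add: z_def norm_scaleC norm_divide)
    have norm_le: "unit_ball_norm (\<phi> i) \<le> C * K * R * cmod (\<phi> i z)" if i: "i \<in> {1..m}" for i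
    proof (rule unit_ball_norm_least)
      fix x :: 'a assume "x \<in> cball 0 1"
      then have "C * (cmod (\<phi> i b1) + cmod (\<phi> i b2)) * norm x \<le> C * (cmod (\<phi> i b1) + cmod (\<phi> i b2)) * 1"
        using C(1) by (intro mult_left_mono) auto
      with C(2)[OF \<phi>[OF i], of x] have "cmod (\<phi> i x) \<le> C * (cmod (\<phi> i b1) + cmod (\<phi> i b2))"
        by linarith
      also have "\<dots> \<le> C * (K * cmod (\<phi> i b1 + of_nat s * \<phi> i b2))"
        using C(1) large[OF i] by (intro mult_left_mono) auto
      also have "\<phi> i b1 + of_nat s * \<phi> i b2 = of_real R * \<phi> i z"
        using \<phi>[OF i] R by (simp add: z_def Vector_Spaces.linear_iff)
      also have "C * (K * cmod (of_real R * \<phi> i z)) = C * K * R * cmod (\<phi> i z)"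
        using R by (simp add: norm_mult)
      finally show "cmod (\<phi> i x) \<le> C * K * R * cmod (\<phi> i z)" .
    qed
    have bdd: "bounded_on_unit_ball (\<phi> i)" if "i \<in> {1..m}" for i
      using linear_functional_bounded_on_unit_ball[OF \<phi>[OF that]] .
    have "(\<Prod>i=1..m. unit_ball_norm (\<phi> i)) \<le> (\<Prod>i=1..m. C * K * R * cmod (\<phi> i z))"
      using norm_le bdd unit_ball_norm_nonneg by (intro prod_mono) auto
    also have "\<dots> = (C * K * R) ^ m * cmod (\<Prod>i=1..m. \<phi> i z)"
      by (simp add: prod.distrib prod_norm power_mult_distrib)
    also have "\<dots> \<le> (C * K * R) ^ m * unit_ball_norm (\<lambda>z. \<Prod>i=1..m. \<phi> i z)"
      using C(1) K R z bdd
      by (intro mult_left_mono unit_ball_norm_upper bounded_on_unit_ball_prod) auto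
    finally show ?thesis .
  qed
  then show ?thesis
    unfolding continuous_linear_functional_def by blast
qed

lemma linear_polarization_inequality:
  assumes "\<And>i. i \<in> {1..m} \<Longrightarrow> continuous_linear_functional scaleC (\<phi> i)"
  shows "(\<Prod>i=1..m. unit_ball_norm (\<phi> i)) \<le>
    linear_polarization_constant scaleC m * unit_ball_norm (\<lambda>z. \<Prod>i=1..m. \<phi> i z)"
proof -
  let ?Q = "\<lambda>\<phi>. \<forall>i\<in>{1..m}. continuous_linear_functional scaleC (\<phi> i)"
  let ?N = "\<lambda>\<phi>. unit_ball_norm (\<lambda>z. \<Prod>i=1..m. \<phi> i z)"
  obtain M where M: "\<And>\<phi>. ?Q \<phi> \<Longrightarrow> (\<Prod>i=1..m. unit_ball_norm (\<phi> i)) \<le> M * ?N \<phi>"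
    using polarization_bound_exists by blast
  have bdd: "bounded_on_unit_ball (\<lambda>z. \<Prod>i=1..m. \<phi> i z)" if "?Q \<phi>" for \<phi>
    using that linear_functional_bounded_on_unit_ball
    by (intro bounded_on_unit_ball_prod) (auto simp: continuous_linear_functional_def)
  have Q_u: "?Q (\<lambda>_. u)"
    using linear_combination_functional[of 1 0] by simp
  \<comment> \<open>The \<open>m\<close>-th power of the coordinate \<open>u\<close> does not vanish at the normalized \<open>b\<^sub>1\<close>.\<close>
  define z where "z = of_real (1 / norm b1) *\<^sub>C b1"
  have "b1 \<noteq> 0"
    using dual_basis coordinates(1)[of 0 0] by auto
  then have "z \<in> cball 0 1" "u z \<noteq> 0"
    using linear_u by (simp_all add: z_def norm_scaleC norm_divide Vector_Spaces.linear_iff dual_basis)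
  then have "0 < cmod (\<Prod>i=1..m. u z)" "cmod (\<Prod>i=1..m. u z) \<le> ?N (\<lambda>_. u)"
    using unit_ball_norm_upper[OF bdd[OF Q_u], of z] by simp_all
  then have pos: "0 < ?N (\<lambda>_. u)" by linarith
  show ?thesis
    unfolding linear_polarization_constant_def
  proof (rule Least_ratio_bound[where Q = ?Q and N = ?N and A = "\<lambda>\<phi>. \<Prod>i=1..m. unit_ball_norm (\<phi> i)"])
    show "0 \<le> ?N \<phi>" if "?Q \<phi>" for \<phi>
      using unit_ball_norm_nonneg[OF bdd[OF that]] .
  qed (fact M pos Q_u | use assms in blast)+
qed

text \<open>
  The linear factors of the \<open>P\<^sub>i\<close> are naturally indexed by pairs \<open>(i, j)\<close>; a bijection
  with an initial segment brings them into the form the polarization constant refers to.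
\<close>

lemma product_of_polynomials_inequality:
  fixes n :: nat
  assumes "\<And>i. i \<in> {1..n} \<Longrightarrow> k i \<ge> 1"
    and "\<And>i. i \<in> {1..n} \<Longrightarrow> continuous_homogeneous_polynomial scaleC (k i) (P i)"
  shows "(\<Prod>i=1..n. unit_ball_norm (P i)) \<le>
    linear_polarization_constant scaleC (\<Sum>i=1..n. k i) * unit_ball_norm (\<lambda>z. \<Prod>i=1..n. P i z)"
proof -
  have "\<forall>i\<in>{1..n}. \<exists>\<phi>. (\<forall>j. continuous_linear_functional scaleC (\<phi> j)) \<and> (\<forall>z. P i z = (\<Prod>j=1..k i. \<phi> j z))"
    using assms homogeneous_polynomial_splits by blast
  then obtain \<phi> where \<phi>: "\<And>i j. i \<in> {1..n} \<Longrightarrow> continuous_linear_functional scaleC (\<phi> i j)"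
    and P: "\<And>i z. i \<in> {1..n} \<Longrightarrow> P i z = (\<Prod>j=1..k i. \<phi> i j z)"
    by metis
  have bdd: "bounded_on_unit_ball (\<phi> i j)" if "i \<in> {1..n}" for i j
    using \<phi>[OF that] linear_functional_bounded_on_unit_ball
    by (simp add: continuous_linear_functional_def)
  define I where "I = (SIGMA i:{1..n}. {1..k i})"
  have "card I = (\<Sum>i=1..n. k i)"
    unfolding I_def by (subst card_SigmaI) auto
  then obtain h where h: "bij_betw h {1..(\<Sum>i=1..n. k i)} I"
    using ex_bij_betw_nat_finite_1[of I] by (auto simp: I_def)
  define \<psi> where "\<psi> l = \<phi> (fst (h l)) (snd (h l))" for l
  have flatten: "(\<Prod>i=1..n. \<Prod>j=1..k i. g (\<phi> i j)) = (\<Prod>l=1..(\<Sum>i=1..n. k i). g (\<psi> l))"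
    for g :: "('a \<Rightarrow> complex) \<Rightarrow> 'c::comm_monoid_mult"
    using prod.reindex_bij_betw[OF h, of "\<lambda>(i, j). g (\<phi> i j)"]
    by (simp add: prod.Sigma \<psi>_def case_prod_unfold I_def)
  have P_eq: "P i = (\<lambda>z. \<Prod>j=1..k i. \<phi> i j z)" if "i \<in> {1..n}" for i
    using P[OF that] by auto
  have "(\<Prod>i=1..n. unit_ball_norm (P i)) \<le> (\<Prod>i=1..n. \<Prod>j=1..k i. unit_ball_norm (\<phi> i j))"
    using bdd by (intro prod_mono)
      (auto simp: P_eq intro!: unit_ball_norm_prod_le unit_ball_norm_nonneg bounded_on_unit_ball_prod)
  also have "\<dots> = (\<Prod>l=1..(\<Sum>i=1..n. k i). unit_ball_norm (\<psi> l))"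
    by (rule flatten)
  also have "\<dots> \<le> linear_polarization_constant scaleC (\<Sum>i=1..n. k i) *
      unit_ball_norm (\<lambda>z. \<Prod>l=1..(\<Sum>i=1..n. k i). \<psi> l z)"
  proof (rule linear_polarization_inequality)
    fix l assume "l \<in> {1..(\<Sum>i=1..n. k i)}"
    then have "h l \<in> I" using h by (auto simp: bij_betw_def)
    then show "continuous_linear_functional scaleC (\<psi> l)"
      unfolding \<psi>_def by (intro \<phi>) (auto simp: I_def)
  qed
  also have "(\<lambda>z. \<Prod>l=1..(\<Sum>i=1..n. k i). \<psi> l z) = (\<lambda>z. \<Prod>i=1..n. P i z)"
    using flatten[of "\<lambda>f. f z" for z] by (simp add: P)
  finally show ?thesis .
qed

end

theorem proposition1p3:
  fixes scaleC :: "complex \<Rightarrow> 'a::banach \<Rightarrow> 'a"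
    and n :: nat and k :: "nat \<Rightarrow> nat" and P :: "nat \<Rightarrow> 'a \<Rightarrow> complex"
  assumes "complex_banach_space scaleC"
    and "vector_space.dim scaleC (UNIV :: 'a set) = 2"
    and "n \<ge> 1"
    and "\<And>i. i \<in> {1..n} \<Longrightarrow> k i \<ge> 1"
    and "\<And>i. i \<in> {1..n} \<Longrightarrow> continuous_homogeneous_polynomial scaleC (k i) (P i)"
  shows "(\<Prod>i=1..n. unit_ball_norm (P i)) \<le>
     linear_polarization_constant scaleC (\<Sum>i=1..n. k i) *
       unit_ball_norm (\<lambda>z. \<Prod>i=1..n. P i z)"
proof -
  obtain b1 b2 u v where "complex_plane scaleC b1 b2 u v"
    using complex_banach_space.complex_plane_if_dim_2[OF assms(1,2)] by blast
  then show ?thesis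
    using assms(4,5) by (rule complex_plane.product_of_polynomials_inequality)
qed

end
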